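(* Let $d\geq 4$ be an even integer. A homogeneous polynomial $f\in\mathbb{C}[x_1,x_2]$ of degree $d$ is singular and satisfies $H(f)=\alpha(x_1x_2)^{d-2}$ for some $\alpha\in\mathbb{C}$, $\alpha\neq 0$, if and only if $f=a\,x_1^{d/2}x_2^{d/2}$ for some $a\in\mathbb{C}$, $a\neq 0$.
   Context: For a homogeneous polynomial $f\in \mathbb{C}[x_1,x_2]$, $\mathrm{Hess}(f)=\left(\frac{\partial^2 f}{\partial x_i\partial x_j}\right)_{1\le i,j\le 2}$ is the Hessian matrix and $H(f)=\det(\mathrm{Hess}(f))$. A homogeneous polynomial $f$ of degree $d$ in $x_1,x_2$ is singular if its first partial derivatives $\partial f/\partial x_1,\partial f/\partial x_2$ have a common zero in $\mathbb{P}^1_{\mathbb{C}}$ (equivalently, $f$ has a repeated linear factor or is zero). *)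

theory Defs
  imports "HOL-Analysis.Analysis" "HOL-Computational_Algebra.Computational_Algebra"
begin

text \<open>
  The ring \<open>\<complex>[x\<^sub>1, x\<^sub>2]\<close> is represented as \<open>\<complex>[x\<^sub>1][x\<^sub>2]\<close>, i.e. by the type
  \<^typ>\<open>complex poly poly\<close>: the inner variable is \<open>x\<^sub>1\<close>, the outer variable is \<open>x\<^sub>2\<close>, and
  the coefficient of \<open>x\<^sub>1^i x\<^sub>2^j\<close> in \<open>f\<close> is \<open>coeff (coeff f j) i\<close>.
  Variables are indexed by the two-element type \<^typ>\<open>2\<close>, whose elements are \<open>1\<close> and \<open>2\<close>
  (with \<open>2 = 0\<close>).
\<close>

type_synonym poly2 = "complex poly poly"

definition X1 :: poly2 where
  "X1 = [:[:0, 1:]:]"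

definition X2 :: poly2 where
  "X2 = [:0, 1:]"

definition const :: "complex \<Rightarrow> poly2" where
  "const c = [:[:c:]:]"

definition eval :: "poly2 \<Rightarrow> complex ^ 2 \<Rightarrow> complex" where
  "eval f v = poly (poly f [:v $ 2:]) (v $ 1)"

definition partial_deriv :: "2 \<Rightarrow> poly2 \<Rightarrow> poly2" where
  "partial_deriv i f = (if i = 1 then map_poly pderiv f else pderiv f)"

text \<open>The zero polynomial is homogeneous of every degree.\<close>

definition homogeneous :: "nat \<Rightarrow> poly2 \<Rightarrow> bool" where
  "homogeneous d f \<longleftrightarrow> (\<forall>i j. coeff (coeff f j) i \<noteq> 0 \<longrightarrow> i + j = d)"

definition Hess :: "poly2 \<Rightarrow> poly2 ^ 2 ^ 2" where
  "Hess f = (\<chi> i j. partial_deriv i (partial_deriv j f))"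

definition H :: "poly2 \<Rightarrow> poly2" where
  "H f = det (Hess f)"

text \<open>
  A point of the complex projective line is given by a nonzero vector of homogeneous
  coordinates. For homogeneous \<open>f\<close> the vanishing of the partial derivatives does not depend on
  the choice of coordinates.
\<close>

definition singular :: "poly2 \<Rightarrow> bool" where
  "singular f \<longleftrightarrow> (\<exists>v :: complex ^ 2. v \<noteq> 0 \<and> (\<forall>i. eval (partial_deriv i f) v = 0))"

end

theory Submission
  imports Defs
begin

text \<open>
  Only the implication from left to right needs an idea; the other one is a computation.

  Let \<open>f\<close> have degree \<open>d\<close> and a singular point \<open>(r : 1)\<close>, and pass to the one-variable polynomial
  \<open>a(x) = f(x, 1)\<close>. Euler's relations for \<open>f\<close> and its first partial derivatives express all second
  derivatives along \<open>x\<^sub>2 = 1\<close> by \<open>a\<close>, \<open>a'\<close>, \<open>a''\<close>, and the Hessian condition becomes the ordinary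
  differential equation \<open>P := d a a'' - (d - 1) a'\<^sup>2 = c x^(d - 2)\<close> with \<open>c \<noteq> 0\<close>
  (\<open>hessian_of_dehomogenization\<close>). If \<open>a\<close> vanishes at \<open>r\<close> together with its derivative, so
  does \<open>P\<close>; hence \<open>r = 0\<close>. If \<open>a\<close> vanishes at \<open>0\<close> to order \<open>0 < k < d\<close>, then \<open>P\<close> vanishes there
  to order exactly \<open>2k - 2\<close>, since the leading coefficient is a multiple of \<open>k (k - d)\<close>; hence
  \<open>k = d/2\<close> (\<open>order_zero_of_monomial_hessian\<close>).

  It remains to see that \<open>a\<close> has no root other than \<open>0\<close>. Put \<open>E = x a'' - (d - 1) a'\<close>. Since
  \<open>x P' = (d - 2) P\<close>, one gets \<open>d a E' = (d - 2) a' E\<close>, which says that \<open>E^d\<close> and \<open>a^(d - 2)\<close> are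
  proportional; and \<open>E \<noteq> 0\<close>, as its coefficient at \<open>x^(d/2 - 1)\<close> does not vanish. So \<open>d\<close> times the
  order of \<open>E\<close> is \<open>d - 2\<close> times the order of \<open>a\<close> at every point
  (\<open>order_of_proportional_log_derivatives\<close>). A root \<open>x \<noteq> 0\<close> of \<open>a\<close> is simple, because \<open>P(x) \<noteq> 0\<close>,
  so \<open>d\<close> would divide \<open>d - 2\<close>, which is impossible for \<open>d \<ge> 3\<close>. Thus \<open>a\<close> is a constant multiple of
  \<open>x^(d/2)\<close> (\<open>monomial_of_monomial_hessian\<close>), and \<open>f\<close> is recovered from \<open>a\<close> by homogeneity. The
  remaining singular point \<open>(1 : 0)\<close> is treated in the same way with \<open>f(1, y)\<close>.
\<close>

section \<open>Orders of vanishing and logarithmic derivatives\<close>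

text \<open>
  Multiplying the derivative by \<open>x - r\<close> makes it divisible by the same power of \<open>x - r\<close> as \<open>p\<close>,
  with a cofactor whose value at \<open>r\<close> is \<open>m s(r)\<close>. In this form no exponent \<open>m - 1\<close> appears,
  and \<open>m = 0\<close> is not exceptional.
\<close>

lemma times_pderiv_root_power:
  fixes s :: "'a :: idom poly"
  assumes "p = [:- r, 1:] ^ m * s"
  shows "[:- r, 1:] * pderiv p = [:- r, 1:] ^ m * (of_nat m * s + [:- r, 1:] * pderiv s)"
proof (cases m)
  case 0
  then show ?thesis using assms by simp
next
  case (Suc n)
  define Y where "Y = [:- r, 1:]"
  have "pderiv Y = 1"
    by (simp add: Y_def pderiv_pCons)
  then have "pderiv (Y ^ m) = of_nat m * Y ^ n"
    by (simp add: Suc pderiv_power_Suc of_nat_poly del: power_Suc)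
  then have "pderiv p = of_nat m * Y ^ n * s + Y ^ m * pderiv s"
    using assms by (simp add: pderiv_mult Y_def[symmetric] mult_ac)
  moreover have "Y * (of_nat m * Y ^ n * s + Y ^ m * pderiv s) = Y ^ m * (of_nat m * s + Y * pderiv s)"
    by (simp add: Suc algebra_simps)
  ultimately show ?thesis
    by (simp add: Y_def)
qed

lemma pderiv_of_nat_mult: "pderiv (of_nat n * p) = of_nat n * pderiv p"
  by (simp add: of_nat_poly pderiv_smult)

text \<open>
  The hypothesis reads \<open>c q'/q = c' p'/p\<close>, and the residue of a logarithmic derivative at \<open>r\<close> is the
  order of vanishing there. Comparing the two residues gives the claim.
\<close>

lemma order_of_proportional_log_derivatives:
  fixes p q :: "'a :: idom poly"
  assumes "p \<noteq> 0" "q \<noteq> 0"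
    and eq: "of_nat c * p * pderiv q = of_nat c' * pderiv p * q"
  shows "of_nat (c * order r q) = (of_nat (c' * order r p) :: 'a)"
proof -
  define Y where "Y = [:- r, 1:]"
  define m k where "m = order r p" and "k = order r q"
  obtain s where s: "p = Y ^ m * s" "\<not> Y dvd s"
    using order_decomp[OF \<open>p \<noteq> 0\<close>] unfolding Y_def m_def by metis
  obtain t where t: "q = Y ^ k * t" "\<not> Y dvd t"
    using order_decomp[OF \<open>q \<noteq> 0\<close>] unfolding Y_def k_def by metis
  have nz: "poly s r \<noteq> 0" "poly t r \<noteq> 0"
    using s(2) t(2) by (auto simp: Y_def poly_eq_0_iff_dvd)
  have "of_nat c * p * (Y * pderiv q) = of_nat c' * (Y * pderiv p) * q"
    using arg_cong[OF eq, of "\<lambda>u. Y * u"] by (simp only: mult_ac)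
  then have "of_nat c * p * (Y ^ k * (of_nat k * t + Y * pderiv t)) =
      of_nat c' * (Y ^ m * (of_nat m * s + Y * pderiv s)) * q"
    using times_pderiv_root_power[OF s(1)[unfolded Y_def]]
      times_pderiv_root_power[OF t(1)[unfolded Y_def]]
    by (simp only: Y_def)
  then have "Y ^ (m + k) * (of_nat c * s * (of_nat k * t + Y * pderiv t)) =
      Y ^ (m + k) * (of_nat c' * (of_nat m * s + Y * pderiv s) * t)"
    by (simp only: s(1) t(1) power_add mult_ac)
  moreover have "Y ^ (m + k) \<noteq> 0"
    by (simp add: Y_def)
  ultimately have "of_nat c * s * (of_nat k * t + Y * pderiv t) =
      of_nat c' * (of_nat m * s + Y * pderiv s) * t"
    by (metis mult_left_cancel)
  from arg_cong[OF this, of "\<lambda>u. poly u r"]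
  have "poly s r * poly t r * of_nat (c * k) = poly s r * poly t r * of_nat (c' * m)"
    by (simp add: Y_def mult_ac)
  then show ?thesis
    using nz by (simp add: m_def k_def del: of_nat_mult)
qed

section \<open>The one-variable differential equation\<close>

text \<open>
  Write \<open>a = x^k b\<close> with \<open>b(0) \<noteq> 0\<close>. The left side of the differential equation, multiplied by \<open>x\<^sup>2\<close>,
  is \<open>x^(2k) Q\<close> with \<open>Q(0) = k (k - d) b(0)\<^sup>2\<close>, while the right side becomes \<open>c x^d\<close>. So
  \<open>2k \<le> d\<close>, which for \<open>d > 0\<close> rules out \<open>k = d\<close>; then \<open>Q(0) \<noteq> 0\<close> and \<open>2k = d\<close>.
\<close>

lemma order_zero_of_monomial_hessian:
  fixes a :: "'a :: {idom, ring_char_0} poly"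
  assumes "d \<ge> 2" "poly a 0 = 0" "c \<noteq> 0"
    and eq: "of_nat d * a * pderiv (pderiv a) - of_nat (d - 1) * pderiv a ^ 2 = monom c (d - 2)"
  shows "d = 2 * order 0 a"
proof -
  define X where "X = [:- 0, 1 :: 'a:]"
  define k where "k = order 0 a"
  have "a \<noteq> 0"
    using eq \<open>c \<noteq> 0\<close> by auto
  obtain b where b: "a = X ^ k * b" "\<not> X dvd b"
    using order_decomp[OF \<open>a \<noteq> 0\<close>, of 0] unfolding X_def k_def by metis
  have b0: "poly b 0 \<noteq> 0"
    using b(2) by (auto simp: X_def poly_eq_0_iff_dvd)
  have "k > 0"
    using \<open>a \<noteq> 0\<close> \<open>poly a 0 = 0\<close> by (simp add: k_def order_root)
  define b1 where "b1 = of_nat k * b + X * pderiv b"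
  have a1: "X * pderiv a = X ^ k * b1"
    using times_pderiv_root_power[OF b(1)[unfolded X_def]] by (simp add: X_def b1_def)
  have "X * pderiv (X * pderiv a) = X ^ k * (of_nat k * b1 + X * pderiv b1)"
    using times_pderiv_root_power[OF a1[unfolded X_def]] by (simp add: X_def)
  moreover have "pderiv (X * pderiv a) = pderiv a + X * pderiv (pderiv a)"
    by (simp add: X_def pderiv_mult pderiv_pCons)
  ultimately have a2: "X ^ 2 * pderiv (pderiv a) = X ^ k * (of_nat k * b1 + X * pderiv b1 - b1)"
    using a1 by (simp add: algebra_simps power2_eq_square)
  define Q where "Q = of_nat d * b * (of_nat k * b1 + X * pderiv b1 - b1) - of_nat (d - 1) * b1 ^ 2"
  have "X ^ 2 * (of_nat d * a * pderiv (pderiv a) - of_nat (d - 1) * pderiv a ^ 2) =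
      of_nat d * a * (X ^ 2 * pderiv (pderiv a)) - of_nat (d - 1) * (X * pderiv a) ^ 2"
    by algebra
  also have "\<dots> = of_nat d * (X ^ k * b) * (X ^ k * (of_nat k * b1 + X * pderiv b1 - b1))
      - of_nat (d - 1) * (X ^ k * b1) ^ 2"
    by (simp only: a1 a2 flip: b(1))
  also have "\<dots> = X ^ (2 * k) * Q"
    unfolding Q_def mult_2 power_add by algebra
  finally have *: "X ^ 2 * monom c (d - 2) = X ^ (2 * k) * Q"
    by (simp only: eq)
  have "X ^ 2 * X ^ (d - 2) = X ^ d"
    using \<open>d \<ge> 2\<close> by (metis power_add le_add_diff_inverse)
  then have "X ^ 2 * monom c (d - 2) = smult c (X ^ d)"
    by (simp only: X_def monom_altdef minus_zero mult_smult_right)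
  with * have Q: "smult c (X ^ d) = X ^ (2 * k) * Q"
    by simp
  have "smult c (X ^ d) \<noteq> 0"
    using \<open>c \<noteq> 0\<close> by (simp add: X_def)
  then have "d = 2 * k + order 0 Q"
    using Q \<open>c \<noteq> 0\<close> order_power_n_n[of "0 :: 'a" d] order_power_n_n[of "0 :: 'a" "2 * k"]
    by (metis X_def order_mult order_smult)
  moreover have "poly Q 0 \<noteq> 0"
  proof -
    have "poly Q 0 = poly b 0 ^ 2 *
        (of_nat d * of_nat k * (of_nat k - 1) - of_nat (d - 1) * of_nat k ^ 2)"
      by (simp add: Q_def b1_def X_def power2_eq_square algebra_simps)
    also have "\<dots> = poly b 0 ^ 2 * (of_nat k * (of_nat k - of_nat d))"
      using \<open>d \<ge> 2\<close> by (simp add: of_nat_diff power2_eq_square algebra_simps)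
    finally show ?thesis
      using b0 \<open>k > 0\<close> \<open>d = 2 * k + order 0 Q\<close> by (simp del: of_nat_add)
  qed
  ultimately show ?thesis
    by (simp add: k_def order_0I)
qed

text \<open>
  A common zero \<open>r\<close> of \<open>a\<close> and \<open>a'\<close> must be \<open>0\<close>, which fixes the order of \<open>a\<close> at \<open>0\<close>. Any other
  root would be simple, and the first-order relation between \<open>E\<close> and \<open>a\<close> forbids simple roots.
\<close>

lemma monomial_of_monomial_hessian:
  fixes a :: "complex poly"
  assumes "d \<ge> 3" "c \<noteq> 0" "poly a r = 0" "poly (pderiv a) r = 0"
    and eq: "of_nat d * a * pderiv (pderiv a) - of_nat (d - 1) * pderiv a ^ 2 = monom c (d - 2)"
  shows "\<exists>n e. d = 2 * n \<and> e \<noteq> 0 \<and> a = monom e n"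
proof -
  define X where "X = [:0, 1 :: complex:]"
  define k where "k = order 0 a"
  have dX: "pderiv X = 1"
    by (simp add: X_def pderiv_pCons)
  have eq_at: "of_nat d * poly a x * poly (pderiv (pderiv a)) x
      - of_nat (d - 1) * poly (pderiv a) x ^ 2 = c * x ^ (d - 2)" for x
    using arg_cong[OF eq, of "\<lambda>u. poly u x"] by (simp add: poly_monom)
  have "r = 0"
    using eq_at[of r] assms by simp
  then have "poly a 0 = 0"
    using assms by simp
  have d: "d = 2 * k"
    unfolding k_def
    by (rule order_zero_of_monomial_hessian[OF _ \<open>poly a 0 = 0\<close> \<open>c \<noteq> 0\<close> eq]) (use \<open>d \<ge> 3\<close> in simp)
  have "a \<noteq> 0"
    using eq \<open>c \<noteq> 0\<close> by auto
  have "k \<ge> 2"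
    using d \<open>d \<ge> 3\<close> by simp
  have ord1: "order 0 a = Suc (order 0 (pderiv a))"
    by (rule order_pderiv[OF \<open>a \<noteq> 0\<close> \<open>poly a 0 = 0\<close>])
  have "pderiv a \<noteq> 0"
    using ord1 \<open>k \<ge> 2\<close> eq \<open>c \<noteq> 0\<close> by auto

  (* E is the combination for which E' = x a''' - (d - 2) a'' has exactly the shape that the
     differentiated equation produces. *)
  define E where "E = X * pderiv (pderiv a) - of_nat (d - 1) * pderiv a"
  have dE: "pderiv E = X * pderiv (pderiv (pderiv a)) - of_nat (d - 2) * pderiv (pderiv a)"
    using \<open>d \<ge> 3\<close>
    by (simp add: E_def pderiv_diff pderiv_of_nat_mult pderiv_add pderiv_mult[of X] dX of_nat_diff algebra_simps)
  have "E \<noteq> 0"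
  proof
    (* Otherwise a' would satisfy x (a')' = (d - 1) a' and vanish at 0 to order d - 1,
       but it vanishes there to order d/2 - 1. *)
    assume "E = 0"
    then have "of_nat 1 * X * pderiv (pderiv a) = of_nat (d - 1) * pderiv X * pderiv a"
      by (simp add: E_def dX)
    from order_of_proportional_log_derivatives[OF _ \<open>pderiv a \<noteq> 0\<close> this, of 0]
    have "order 0 (pderiv a) = (d - 1) * order 0 X"
      by (simp add: X_def del: of_nat_mult)
    moreover have "order 0 X = 1"
      using order_power_n_n[of "0 :: complex" 1] by (simp add: X_def)
    ultimately show False
      using ord1 d \<open>k \<ge> 2\<close> by (simp add: k_def)
  qed
  have E_eq: "of_nat d * a * pderiv E = of_nat (d - 2) * pderiv a * E"
  proof -
    (* The right-hand side of the equation is homogeneous of degree d - 2, so c is eliminated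
       by Euler's relation in one variable. *)
    have "X * pderiv (monom c (d - 2)) = of_nat (d - 2) * monom c (d - 2)"
      using \<open>d \<ge> 3\<close> Suc_diff_le[of 3 d]
      by (simp add: X_def pderiv_monom of_nat_poly smult_monom flip: monom_Suc)
    then have "X * pderiv (of_nat d * a * pderiv (pderiv a) - of_nat (d - 1) * pderiv a ^ 2) =
        of_nat (d - 2) * (of_nat d * a * pderiv (pderiv a) - of_nat (d - 1) * pderiv a ^ 2)"
      by (simp only: eq)
    moreover have "pderiv (of_nat d * a * pderiv (pderiv a) - of_nat (d - 1) * pderiv a ^ 2) =
        of_nat d * (pderiv a * pderiv (pderiv a) + a * pderiv (pderiv (pderiv a)))
        - of_nat (d - 1) * (2 * pderiv a * pderiv (pderiv a))"
      by (simp only: pderiv_diff pderiv_of_nat_mult pderiv_mult power2_eq_square mult.assoc)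
        (simp add: algebra_simps)
    ultimately have "X * (of_nat d * (pderiv a * pderiv (pderiv a) + a * pderiv (pderiv (pderiv a)))
        - of_nat (d - 1) * (2 * pderiv a * pderiv (pderiv a))) =
        of_nat (d - 2) * (of_nat d * a * pderiv (pderiv a) - of_nat (d - 1) * pderiv a ^ 2)"
      by (simp only:)
    moreover have "d = (d - 2) + 2"
      using \<open>d \<ge> 3\<close> by simp
    then obtain m where "d = m + 2"
      by blast
    then have "of_nat d = (of_nat m + 2 :: complex poly)" "of_nat (d - 1) = (of_nat m + 1 :: complex poly)"
      "of_nat (d - 2) = (of_nat m :: complex poly)"
      by (simp_all del: of_nat_diff)
    ultimately show ?thesis
      unfolding dE unfolding E_def by algebra
  qed

  have no_root: "poly a x \<noteq> 0" if "x \<noteq> 0" for x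
  proof
    assume "poly a x = 0"
    then have "poly (pderiv a) x \<noteq> 0"
      using eq_at[of x] that \<open>c \<noteq> 0\<close> by auto
    then have "order x a = 1"
      using order_pderiv[OF \<open>a \<noteq> 0\<close> \<open>poly a x = 0\<close>] by (simp add: order_0I)
    then have "d * order x E = d - 2"
      using order_of_proportional_log_derivatives[OF \<open>a \<noteq> 0\<close> \<open>E \<noteq> 0\<close> E_eq, of x]
      by (simp only: of_nat_eq_iff mult_1_right)
    then show False
      using \<open>d \<ge> 3\<close> by (cases "order x E") auto
  qed
  obtain b where b: "a = X ^ k * b" "\<not> X dvd b"
    using order_decomp[OF \<open>a \<noteq> 0\<close>, of 0] unfolding X_def k_def by (metis minus_zero)
  have "poly b x \<noteq> 0" for x
  proof (cases "x = 0")
    case True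
    then show ?thesis
      using b(2) by (auto simp: X_def poly_eq_0_iff_dvd)
  next
    case False
    then show ?thesis
      using no_root[of x] by (auto simp: b(1))
  qed
  then have "degree b = 0"
    using alg_closed_imp_poly_has_root[of b] by blast
  then obtain e where e: "b = [:e:]"
    using degree_0_id by (metis)
  then have "a = monom e k"
    using b(1) by (simp add: X_def monom_altdef)
  with \<open>a \<noteq> 0\<close> d show ?thesis
    by auto
qed

section \<open>The Hessian in an affine chart\<close>

text \<open>
  The hypotheses are Euler's relations for a form of degree \<open>d\<close> and for its two first partial
  derivatives, restricted to the line where the second variable is \<open>1\<close>: \<open>a\<close> is the restriction of the
  form, \<open>f2\<close>, \<open>h12\<close>, \<open>h22\<close> are those of its derivatives with the indicated indices. They are
  kept abstract so that the same computation serves both affine charts of the projective line.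
\<close>

lemma hessian_of_dehomogenization:
  fixes a f2 h12 h22 :: "'a :: idom poly"
  assumes "d > 0"
    and "[:0, 1:] * pderiv a + f2 = of_nat d * a"
    and "[:0, 1:] * pderiv (pderiv a) + h12 = of_nat (d - 1) * pderiv a"
    and "[:0, 1:] * h12 + h22 = of_nat (d - 1) * f2"
  shows "pderiv (pderiv a) * h22 - h12 ^ 2 =
    of_nat (d - 1) * (of_nat d * a * pderiv (pderiv a) - of_nat (d - 1) * pderiv a ^ 2)"
proof -
  obtain m where m: "d = Suc m"
    using \<open>d > 0\<close> by (metis Suc_pred)
  show ?thesis
    using assms(2-) unfolding m diff_Suc_1 of_nat_Suc by algebra
qed

text \<open>
  In a chart, a singular point is a common zero \<open>r\<close> of \<open>a'\<close> and \<open>f2\<close>; by Euler's relation it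
  is also a zero of \<open>a\<close>.
\<close>

lemma monomial_of_hessian_power:
  fixes a f2 h12 h22 :: "complex poly"
  assumes "d \<ge> 3" "c \<noteq> 0"
    and euler: "[:0, 1:] * pderiv a + f2 = of_nat d * a"
      "[:0, 1:] * pderiv (pderiv a) + h12 = of_nat (d - 1) * pderiv a"
      "[:0, 1:] * h12 + h22 = of_nat (d - 1) * f2"
    and hess: "pderiv (pderiv a) * h22 - h12 ^ 2 = monom c (d - 2)"
    and crit: "poly (pderiv a) r = 0" "poly f2 r = 0"
  shows "\<exists>n e. d = 2 * n \<and> e \<noteq> 0 \<and> a = monom e n"
proof (rule monomial_of_monomial_hessian)
  show "c / of_nat (d - 1) \<noteq> 0"
    using assms by simp
  show "poly a r = 0"
    using arg_cong[OF euler(1), of "\<lambda>u. poly u r"] crit \<open>d \<ge> 3\<close> by simp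
  have "of_nat (d - 1) * (of_nat d * a * pderiv (pderiv a) - of_nat (d - 1) * pderiv a ^ 2) = monom c (d - 2)"
    using hessian_of_dehomogenization[OF _ euler] hess \<open>d \<ge> 3\<close> by simp
  also have "\<dots> = of_nat (d - 1) * monom (c / of_nat (d - 1)) (d - 2)"
    using \<open>d \<ge> 3\<close> by (simp add: of_nat_poly smult_monom del: of_nat_diff)
  finally show "of_nat d * a * pderiv (pderiv a) - of_nat (d - 1) * pderiv a ^ 2 =
      monom (c / of_nat (d - 1)) (d - 2)"
    using \<open>d \<ge> 3\<close> by (simp del: of_nat_diff)
qed (use assms in auto)

section \<open>Dehomogenization\<close>

text \<open>
  The names tell which variable is set to \<open>1\<close>: \<open>dehom1\<close> is \<open>f(1, y)\<close> and \<open>dehom2\<close> is \<open>f(x, 1)\<close>.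
\<close>

abbreviation dehom1 :: "poly2 \<Rightarrow> complex poly" where
  "dehom1 f \<equiv> map_poly (\<lambda>p. poly p 1) f"

abbreviation dehom2 :: "poly2 \<Rightarrow> complex poly" where
  "dehom2 f \<equiv> poly f 1"

lemma coeff_dehom1: "coeff (dehom1 f) j = poly (coeff f j) 1"
  by (simp add: coeff_map_poly)

lemma dehom1_arith [simp]:
  "dehom1 (f + g) = dehom1 f + dehom1 g"
  "dehom1 (f - g) = dehom1 f - dehom1 g"
  "dehom1 (f * g) = dehom1 f * dehom1 g"
  "dehom1 1 = 1"
  by (rule poly_eqI; simp add: coeff_dehom1 coeff_mult poly_sum)+

lemma dehom1_power [simp]: "dehom1 (f ^ n) = dehom1 f ^ n"
  by (induction n) simp_all

lemma dehom1_of_nat [simp]: "dehom1 (of_nat n) = of_nat n"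
  by (induction n) simp_all

lemma dehom1_pderiv: "dehom1 (pderiv f) = pderiv (dehom1 f)"
  by (rule poly_eqI) (simp add: coeff_dehom1 coeff_pderiv)

lemma dehom2_pderiv: "dehom2 (map_poly pderiv f) = pderiv (dehom2 f)"
  by (induction f rule: pCons_induct) (simp_all add: map_poly_pCons pderiv_add)

section \<open>Partial derivatives and homogeneity\<close>

lemma partial_deriv_simps:
  "partial_deriv 1 f = map_poly pderiv f" "partial_deriv 2 f = pderiv f"
  by (simp_all add: partial_deriv_def)

lemma partial_deriv_monom:
  "partial_deriv 1 (monom (monom a i) j) = monom (monom (of_nat i * a) (i - 1)) j"
  "partial_deriv 2 (monom (monom a i) j) = monom (monom (of_nat j * a) i) (j - 1)"
  by (simp_all add: partial_deriv_simps map_poly_monom pderiv_monom of_nat_poly smult_monom)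

lemma map_poly_pderiv_pderiv: "map_poly pderiv (pderiv f) = pderiv (map_poly pderiv f)" for f :: poly2
  by (intro poly_eqI) (simp add: coeff_map_poly coeff_pderiv of_nat_poly pderiv_smult algebra_simps)

lemma H_eq:
  "H f = partial_deriv 1 (partial_deriv 1 f) * partial_deriv 2 (partial_deriv 2 f)
    - partial_deriv 1 (partial_deriv 2 f) ^ 2"
  by (simp add: H_def Hess_def det_2 partial_deriv_simps map_poly_pderiv_pderiv power2_eq_square)

lemma homogeneous_partial_deriv:
  assumes "homogeneous d f"
  shows "homogeneous (d - 1) (partial_deriv i f)"
  unfolding homogeneous_def
proof (intro allI impI)
  fix k j assume "coeff (coeff (partial_deriv i f) j) k \<noteq> 0"
  then have "coeff (coeff f j) (Suc k) \<noteq> 0 \<or> coeff (coeff f (Suc j)) k \<noteq> 0"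
    by (auto simp: partial_deriv_def coeff_map_poly coeff_pderiv of_nat_poly split: if_splits)
  then have "Suc k + j = d \<or> k + Suc j = d"
    using assms unfolding homogeneous_def by blast
  then show "k + j = d - 1"
    by auto
qed

lemma homogeneous_euler:
  assumes "homogeneous d f"
  shows "X1 * partial_deriv 1 f + X2 * partial_deriv 2 f = of_nat d * f"
proof (intro poly_eqI)
  fix j i
  have "(of_nat i + of_nat j) * coeff (coeff f j) i = of_nat d * coeff (coeff f j) i"
    using assms unfolding homogeneous_def by (metis mult_eq_0_iff of_nat_add)
  then show "coeff (coeff (X1 * partial_deriv 1 f + X2 * partial_deriv 2 f) j) i = coeff (coeff (of_nat d * f) j) i"
    by (cases i; cases j)
      (auto simp: X1_def X2_def partial_deriv_simps coeff_map_poly coeff_pderiv of_nat_poly coeff_pCons algebra_simps)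
qed

lemma homogeneous_eqI:
  assumes "homogeneous d f" "homogeneous d g"
    and "\<And>i j. i + j = d \<Longrightarrow> coeff (coeff f j) i = coeff (coeff g j) i"
  shows "f = g"
proof (intro poly_eqI)
  fix j i
  show "coeff (coeff f j) i = coeff (coeff g j) i"
    using assms unfolding homogeneous_def by (cases "i + j = d") metis+
qed

lemma homogeneous_monom: "homogeneous (i + j) (monom (monom a i) j)"
  by (simp add: homogeneous_def)

lemma homogeneous_sum:
  assumes "\<And>k. k \<in> A \<Longrightarrow> homogeneous d (g k)"
  shows "homogeneous d (sum g A)"
  unfolding homogeneous_def
proof (intro allI impI)
  fix i j assume "coeff (coeff (sum g A) j) i \<noteq> 0"
  then obtain k where "k \<in> A" "coeff (coeff (g k) j) i \<noteq> 0"
    unfolding coeff_sum by (rule sum.not_neutral_contains_not_neutral)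
  then show "i + j = d"
    using assms unfolding homogeneous_def by blast
qed

lemma homogeneous_expansion:
  assumes "homogeneous d f"
  shows "f = (\<Sum>j\<le>d. monom (monom (coeff (coeff f j) (d - j)) (d - j)) j)"
proof (rule homogeneous_eqI[OF assms])
  show "homogeneous d (\<Sum>j\<le>d. monom (monom (coeff (coeff f j) (d - j)) (d - j)) j)"
  proof (rule homogeneous_sum)
    fix j assume "j \<in> {..d}"
    then show "homogeneous d (monom (monom (coeff (coeff f j) (d - j)) (d - j)) j)"
      using homogeneous_monom[of "d - j" j] by simp
  qed
next
  fix i j assume "i + j = d"
  moreover have "coeff (coeff (\<Sum>j\<le>d. monom (monom (coeff (coeff f j) (d - j)) (d - j)) j) j) i =
      (\<Sum>k\<le>d. if k = j then coeff (monom (coeff (coeff f j) (d - j)) (d - j)) i else 0)"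
    unfolding coeff_sum by (intro sum.cong) auto
  moreover have "j \<le> d" "d - j = i"
    using \<open>i + j = d\<close> by simp_all
  ultimately show "coeff (coeff f j) i =
      coeff (coeff (\<Sum>j\<le>d. monom (monom (coeff (coeff f j) (d - j)) (d - j)) j) j) i"
    by (simp only: sum.delta finite_atMost atMost_iff if_True coeff_monom refl)
qed

lemma eval_homogeneous:
  fixes v :: "complex ^ 2"
  assumes "homogeneous d f"
  shows "eval f v = (\<Sum>j\<le>d. coeff (coeff f j) (d - j) * (v $ 1) ^ (d - j) * (v $ 2) ^ j)"
  by (subst homogeneous_expansion[OF assms])
    (simp add: eval_def poly_sum poly_monom poly_const_pow mult_ac)

lemma dehom2_homogeneous:
  assumes "homogeneous d f"
  shows "dehom2 f = (\<Sum>j\<le>d. monom (coeff (coeff f j) (d - j)) (d - j))"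
  by (subst homogeneous_expansion[OF assms]) (simp add: poly_sum poly_monom)

lemma dehom1_homogeneous:
  assumes "homogeneous d f"
  shows "dehom1 f = (\<Sum>j\<le>d. monom (coeff (coeff f j) (d - j)) j)"
proof -
  have "dehom1 (sum g A) = (\<Sum>k\<in>A. dehom1 (g k))" for g :: "nat \<Rightarrow> poly2" and A
    by (induction A rule: infinite_finite_induct) simp_all
  then show ?thesis
    by (subst homogeneous_expansion[OF assms]) (simp add: map_poly_monom poly_monom)
qed

text \<open>
  Transfers zeros on the projective line to zeros in the chart \<open>x\<^sub>2 \<noteq> 0\<close>.
\<close>

lemma eval_eq_dehom2:
  fixes v :: "complex ^ 2"
  assumes "homogeneous d f" "v $ 2 \<noteq> 0"
  shows "eval f v = (v $ 2) ^ d * poly (dehom2 f) (v $ 1 / v $ 2)"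
  unfolding eval_homogeneous[OF assms(1)] dehom2_homogeneous[OF assms(1)]
    poly_sum poly_monom sum_distrib_left
  using assms(2) by (intro sum.cong) (auto simp: power_diff field_simps)

lemma eval_eq_dehom1:
  fixes v :: "complex ^ 2"
  assumes "homogeneous d f" "v $ 1 \<noteq> 0"
  shows "eval f v = (v $ 1) ^ d * poly (dehom1 f) (v $ 2 / v $ 1)"
  unfolding eval_homogeneous[OF assms(1)] dehom1_homogeneous[OF assms(1)]
    poly_sum poly_monom sum_distrib_left
  using assms(2) by (intro sum.cong) (auto simp: power_diff field_simps)

lemma coeff_dehom2_homogeneous:
  assumes "homogeneous d f" "i + j = d"
  shows "coeff (dehom2 f) i = coeff (coeff f j) i"
proof -
  have "coeff (dehom2 f) i = (\<Sum>k\<le>d. if k = j then coeff (coeff f k) (d - k) else 0)"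
    unfolding dehom2_homogeneous[OF assms(1)] coeff_sum using assms(2) by (intro sum.cong) auto
  then show ?thesis
    using assms(2) by auto
qed

lemma coeff_dehom1_homogeneous:
  assumes "homogeneous d f" "i + j = d"
  shows "coeff (dehom1 f) j = coeff (coeff f j) i"
  unfolding dehom1_homogeneous[OF assms(1)] coeff_sum using assms(2) by (auto simp: coeff_monom)

lemma monomial_of_dehom2:
  assumes "homogeneous (2 * n) f" "dehom2 f = monom e n"
  shows "f = monom (monom e n) n"
proof (rule homogeneous_eqI[OF assms(1)])
  show "homogeneous (2 * n) (monom (monom e n) n)"
    using homogeneous_monom[of n n e] by (simp add: mult_2)
next
  fix i j assume "i + j = 2 * n"
  then show "coeff (coeff f j) i = coeff (coeff (monom (monom e n) n) j) i"
    using coeff_dehom2_homogeneous[OF assms(1), of i j] by (auto simp: assms(2))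
qed

lemma monomial_of_dehom1:
  assumes "homogeneous (2 * n) f" "dehom1 f = monom e n"
  shows "f = monom (monom e n) n"
proof (rule homogeneous_eqI[OF assms(1)])
  show "homogeneous (2 * n) (monom (monom e n) n)"
    using homogeneous_monom[of n n e] by (simp add: mult_2)
next
  fix i j assume "i + j = 2 * n"
  then show "coeff (coeff f j) i = coeff (coeff (monom (monom e n) n) j) i"
    using coeff_dehom1_homogeneous[OF assms(1), of i j] by (auto simp: assms(2))
qed

section \<open>Forms with monomial Hessian\<close>

lemma const_monom: "const a * X1 ^ i * X2 ^ j = monom (monom a i) j"
proof -
  have "X1 ^ i = monom (monom 1 i) 0" "X2 ^ j = monom 1 j" "const a = monom (monom a 0) 0"
    by (simp_all add: X1_def X2_def const_def monom_altdef poly_const_pow)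
  then show ?thesis
    by (simp add: mult_monom)
qed

lemma H_monom:
  assumes "n \<ge> 2"
  shows "H (monom (monom a n) n) =
    monom (monom (a\<^sup>2 * of_nat n ^ 2 * (1 - 2 * of_nat n)) (2 * n - 2)) (2 * n - 2)"
proof -
  have exps: "n - 1 - 1 + n = 2 * n - 2" "n + (n - 1 - 1) = 2 * n - 2" "n - 1 + (n - 1) = 2 * n - 2"
    using assms by auto
  have coeffs: "of_nat (n - 1) * (of_nat n * a) * (of_nat (n - 1) * (of_nat n * a))
      - of_nat n * (of_nat n * a) * (of_nat n * (of_nat n * a)) =
      a\<^sup>2 * of_nat n ^ 2 * (1 - 2 * of_nat n)"
    using assms by (simp add: of_nat_diff algebra_simps power2_eq_square)
  show ?thesis
    unfolding H_eq partial_deriv_monom power2_eq_square[of "monom _ _"] mult_monom exps diff_monom coeffs ..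
qed

text \<open>
  If the singular point has \<open>x\<^sub>2 \<noteq> 0\<close>, the chart \<open>x\<^sub>2 = 1\<close> contains it. Otherwise it is \<open>(1 : 0)\<close>,
  and the chart \<open>x\<^sub>1 = 1\<close> is used, with the roles of the two variables exchanged. That \<open>d\<close> is even
  is part of the conclusion.
\<close>

lemma monomial_of_singular:
  assumes "d \<ge> 3" "homogeneous d f" "singular f"
    and "\<alpha> \<noteq> 0" "H f = const \<alpha> * (X1 * X2) ^ (d - 2)"
  shows "\<exists>n e. d = 2 * n \<and> e \<noteq> 0 \<and> f = monom (monom e n) n"
proof -
  obtain v :: "complex ^ 2" where "v \<noteq> 0" and v: "eval (partial_deriv i f) v = 0" for i
    using \<open>singular f\<close> unfolding singular_def by blast
  note hom = homogeneous_partial_deriv[OF \<open>homogeneous d f\<close>]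
  note euler = homogeneous_euler[OF \<open>homogeneous d f\<close>]
    homogeneous_euler[OF hom[of 1]] homogeneous_euler[OF hom[of 2]]
  note H = assms(5)[unfolded H_eq]
  have comm: "partial_deriv 2 (partial_deriv 1 f) = partial_deriv 1 (partial_deriv 2 f)"
    by (simp add: partial_deriv_simps map_poly_pderiv_pderiv)
  show ?thesis
  proof (cases "v $ 2 = 0")
    case False
    have "\<exists>n e. d = 2 * n \<and> e \<noteq> 0 \<and> dehom2 f = monom e n"
    proof (rule monomial_of_hessian_power[OF \<open>d \<ge> 3\<close> \<open>\<alpha> \<noteq> 0\<close>])
      note dehom2 = arg_cong[where f = dehom2]
      show "[:0, 1:] * pderiv (dehom2 f) + dehom2 (partial_deriv 2 f) = of_nat d * dehom2 f"
        using dehom2[OF euler(1)]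
        by (simp add: X1_def X2_def dehom2_pderiv partial_deriv_simps(1))
      show "[:0, 1:] * pderiv (pderiv (dehom2 f)) + dehom2 (partial_deriv 1 (partial_deriv 2 f))
          = of_nat (d - 1) * pderiv (dehom2 f)"
        using dehom2[OF euler(2)] unfolding comm
        by (simp add: X1_def X2_def dehom2_pderiv partial_deriv_simps(1))
      show "[:0, 1:] * dehom2 (partial_deriv 1 (partial_deriv 2 f))
          + dehom2 (partial_deriv 2 (partial_deriv 2 f)) = of_nat (d - 1) * dehom2 (partial_deriv 2 f)"
        using dehom2[OF euler(3)] by (simp add: X1_def X2_def)
      show "pderiv (pderiv (dehom2 f)) * dehom2 (partial_deriv 2 (partial_deriv 2 f))
          - dehom2 (partial_deriv 1 (partial_deriv 2 f)) ^ 2 = monom \<alpha> (d - 2)"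
        using dehom2[OF H]
        by (simp add: X1_def X2_def const_def dehom2_pderiv partial_deriv_simps(1) monom_altdef)
      show "poly (pderiv (dehom2 f)) (v $ 1 / v $ 2) = 0"
        using v[of 1] False eval_eq_dehom2[OF hom[of 1] False]
        by (simp add: dehom2_pderiv partial_deriv_simps(1))
      show "poly (dehom2 (partial_deriv 2 f)) (v $ 1 / v $ 2) = 0"
        using v[of 2] False eval_eq_dehom2[OF hom[of 2] False] by simp
    qed
    then show ?thesis
      using monomial_of_dehom2 \<open>homogeneous d f\<close> by metis
  next
    case True
    then have v1: "v $ 1 \<noteq> 0"
      using \<open>v \<noteq> 0\<close> by (auto simp: vec_eq_iff forall_2)
    have X: "dehom1 X1 = 1" "dehom1 X2 = [:0, 1:]" "dehom1 (const \<alpha>) = [:\<alpha>:]"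
      by (simp_all add: X1_def X2_def const_def map_poly_pCons)
    have "\<exists>n e. d = 2 * n \<and> e \<noteq> 0 \<and> dehom1 f = monom e n"
    proof (rule monomial_of_hessian_power[OF \<open>d \<ge> 3\<close> \<open>\<alpha> \<noteq> 0\<close>])
      note dehom1 = arg_cong[where f = dehom1]
      show "[:0, 1:] * pderiv (dehom1 f) + dehom1 (partial_deriv 1 f) = of_nat d * dehom1 f"
        using dehom1[OF euler(1)]
        by (simp add: X dehom1_pderiv partial_deriv_simps(2) add.commute)
      show "[:0, 1:] * pderiv (pderiv (dehom1 f)) + dehom1 (partial_deriv 1 (partial_deriv 2 f))
          = of_nat (d - 1) * pderiv (dehom1 f)"
        using dehom1[OF euler(3)]
        by (simp add: X dehom1_pderiv partial_deriv_simps(2) add.commute)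
      show "[:0, 1:] * dehom1 (partial_deriv 1 (partial_deriv 2 f))
          + dehom1 (partial_deriv 1 (partial_deriv 1 f)) = of_nat (d - 1) * dehom1 (partial_deriv 1 f)"
        using dehom1[OF euler(2)] unfolding comm by (simp add: X add.commute)
      show "pderiv (pderiv (dehom1 f)) * dehom1 (partial_deriv 1 (partial_deriv 1 f))
          - dehom1 (partial_deriv 1 (partial_deriv 2 f)) ^ 2 = monom \<alpha> (d - 2)"
        using dehom1[OF H]
        by (simp add: X dehom1_pderiv partial_deriv_simps(2) monom_altdef mult.commute)
      show "poly (pderiv (dehom1 f)) (v $ 2 / v $ 1) = 0"
        using v[of 2] v1 eval_eq_dehom1[OF hom[of 2] v1]
        by (simp add: dehom1_pderiv partial_deriv_simps(2))
      show "poly (dehom1 (partial_deriv 1 f)) (v $ 2 / v $ 1) = 0"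
        using v[of 1] v1 eval_eq_dehom1[OF hom[of 1] v1] by simp
    qed
    then show ?thesis
      using monomial_of_dehom1 \<open>homogeneous d f\<close> by metis
  qed
qed

theorem theorem2p9:
  fixes d :: nat and f :: poly2
  assumes "d \<ge> 4" and "even d" and "homogeneous d f"
  shows "(singular f \<and> (\<exists>\<alpha>. \<alpha> \<noteq> 0 \<and> H f = const \<alpha> * (X1 * X2) ^ (d - 2))) \<longleftrightarrow>
         (\<exists>a. a \<noteq> 0 \<and> f = const a * X1 ^ (d div 2) * X2 ^ (d div 2))"
proof
  have "d \<ge> 3"
    using \<open>d \<ge> 4\<close> by simp
  assume "singular f \<and> (\<exists>\<alpha>. \<alpha> \<noteq> 0 \<and> H f = const \<alpha> * (X1 * X2) ^ (d - 2))"
  then obtain n e where "d = 2 * n" "e \<noteq> 0" "f = monom (monom e n) n"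
    using monomial_of_singular[OF \<open>d \<ge> 3\<close> \<open>homogeneous d f\<close>] by blast
  then show "\<exists>a. a \<noteq> 0 \<and> f = const a * X1 ^ (d div 2) * X2 ^ (d div 2)"
    by (auto simp: const_monom)
next
  assume "\<exists>a. a \<noteq> 0 \<and> f = const a * X1 ^ (d div 2) * X2 ^ (d div 2)"
  then obtain a where "a \<noteq> 0" and f: "f = monom (monom a (d div 2)) (d div 2)"
    by (auto simp: const_monom)
  obtain n where n: "d = 2 * n" "n \<ge> 2"
    using \<open>d \<ge> 4\<close> \<open>even d\<close> by (auto elim!: evenE)
  (* Both partial derivatives are divisible by x\<^sub>2 because the exponent d/2 is at least 2, so (1 : 0)
     is a singular point. *)
  define v :: "complex ^ 2" where "v = (\<chi> i. if i = 1 then 1 else 0)"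
  have "v \<noteq> 0"
    by (auto simp: v_def vec_eq_iff)
  moreover have "eval (partial_deriv i f) v = 0" for i
    using n exhaust_2[of i]
    by (auto simp: f partial_deriv_monom eval_def poly_monom v_def)
  ultimately have "singular f"
    unfolding singular_def by blast
  moreover have "H f = const (a\<^sup>2 * of_nat n ^ 2 * (1 - 2 * of_nat n)) * (X1 * X2) ^ (d - 2)"
    using n by (simp add: f H_monom power_mult_distrib const_monom flip: mult.assoc)
  moreover have "a\<^sup>2 * of_nat n ^ 2 * (1 - 2 * of_nat n) \<noteq> 0"
  proof -
    have "of_nat (2 * n) \<noteq> (of_nat 1 :: complex)"
      unfolding of_nat_eq_iff using n by simp
    then show ?thesis
      using \<open>a \<noteq> 0\<close> n by simp
  qed
  ultimately show "singular f \<and> (\<exists>\<alpha>. \<alpha> \<noteq> 0 \<and> H f = const \<alpha> * (X1 * X2) ^ (d - 2))"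
    by blast
qed

end
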